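(* Let $T\in(0,\infty)$, let $g_1\in L^\infty(0,T)$, and let $g_2,g_3\in L^1(0,T)$ be nonnegative functions. Suppose that $f\in L^\infty(0,T)$ satisfies $$f(t)\le g_1(t)+\int_0^tg_2(s)f(s)\,ds+(g_3*f)(t)\quad\text{for a.e. }t\in(0,T).$$ Then $f(t)\le G(t)$ for a.e. $t\in(0,T)$, where $G\in L^\infty(0,T)$ denotes the unique solution of the Volterra integral equation $$G(t)=g_1(t)+\int_0^tg_2(s)G(s)\,ds+(g_3*G)(t)\quad\text{for }t\in(0,T).$$
   Context: All functions are real-valued. Convolution: $(g*f)(t)=\int_0^tg(t-s)f(s)\,ds$ for $t \in (0,T)$. The integral equation is understood for a.e. $t\in(0,T)$. *)

theory Defs
  imports "HOL-Analysis.Analysis"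
begin

text \<open>
  Elements of the spaces \<open>L\<^sup>1(0,T)\<close> and \<open>L\<^sup>\<infinity>(0,T)\<close> are represented by real functions whose
  values outside \<open>(0,T)\<close> are irrelevant; equality in these spaces is equality almost everywhere.
\<close>

definition L1 :: "real \<Rightarrow> (real \<Rightarrow> real) set" where
  "L1 T = {g. integrable (lebesgue_on {0<..<T}) g}"

definition Linf :: "real \<Rightarrow> (real \<Rightarrow> real) set" where
  "Linf T = {f \<in> borel_measurable (lebesgue_on {0<..<T}).
     \<exists>C. AE t in lebesgue_on {0<..<T}. \<bar>f t\<bar> \<le> C}"

definition conv :: "(real \<Rightarrow> real) \<Rightarrow> (real \<Rightarrow> real) \<Rightarrow> real \<Rightarrow> real" where
  "conv g f t = (LINT s|lebesgue_on {0<..<t}. g (t - s) * f s)"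

definition volterra_rhs ::
  "(real \<Rightarrow> real) \<Rightarrow> (real \<Rightarrow> real) \<Rightarrow> (real \<Rightarrow> real) \<Rightarrow> (real \<Rightarrow> real) \<Rightarrow> real \<Rightarrow> real" where
  "volterra_rhs g1 g2 g3 f t =
     g1 t + (LINT s|lebesgue_on {0<..<t}. g2 s * f s) + conv g3 f t"

definition volterra_solution ::
  "real \<Rightarrow> (real \<Rightarrow> real) \<Rightarrow> (real \<Rightarrow> real) \<Rightarrow> (real \<Rightarrow> real) \<Rightarrow> (real \<Rightarrow> real) \<Rightarrow> bool" where
  "volterra_solution T g1 g2 g3 G \<longleftrightarrow>
     G \<in> Linf T \<and> (AE t in lebesgue_on {0<..<T}. G t = volterra_rhs g1 g2 g3 G t)"

end

theory Submission
  imports Defs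
begin

text \<open>
  Up to null sets the equation reads \<open>G = g1 + K G\<close>, where \<open>K\<close> is the integral operator with the
  nonnegative kernel \<open>k(t,s) = g2 s + g3 (t - s)\<close> for \<open>0 < s < t\<close>. Measured against the weight
  \<open>exp (l * t)\<close> with \<open>l\<close> large, \<open>K\<close> is a contraction: \<open>\<integral> k(t,s) * exp (l * s) ds \<le> exp (l * t) / 2\<close>
  for every \<open>t\<close> in \<open>(0,T)\<close>. To see this, split an integrable coefficient \<open>h\<close> as \<open>min h n + (h - n)\<^sup>+\<close>. The
  second part has small integral once \<open>n\<close> is large, and the bounded part contributes at most
  \<open>n * \<integral> exp (- l * (t - s)) ds \<le> n / l\<close>. Since reflection \<open>s \<mapsto> t - s\<close> preserves the integral of
  the excess, the same splitting handles the convolution, uniformly in \<open>t\<close>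
  (lemma \<open>volterra_kernel_contracting\<close>).

  Contraction gives existence by the Neumann series \<open>\<Sum>n. K\<^sup>n g1\<close>. Positivity gives comparison: if
  \<open>f \<le> g1 + K f\<close> and \<open>G \<ge> g1 + K G\<close>, then \<open>d = f - G\<close> satisfies \<open>d \<le> K d\<close>; a bound
  \<open>d \<le> C * exp (l * t)\<close> therefore improves to \<open>d \<le> C / 2 * exp (l * t)\<close>, and iterating yields
  \<open>d \<le> 0\<close>. Uniqueness is comparison of two solutions in both directions.

  The contraction argument needs jointly measurable kernels on a product space, so it is carried
  out for Borel functions and Lebesgue-Borel measure. Lebesgue measurable data enter through Borel
  representatives, which leave the right-hand side of the equation unchanged
  (lemma \<open>volterra_rhs_eq_kernel_integral\<close>).
\<close>

section \<open>Kernels that contract a weighted supremum norm\<close>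

text \<open>
  Only three features of the Volterra operator matter for comparison and existence: positivity,
  joint measurability, and a weight \<open>w\<close> whose image under the operator is at most \<open>q * w\<close> with
  \<open>q < 1\<close>. For \<open>w > 0\<close> the last property says that the positive operator has norm at most \<open>q\<close> on
  the space of functions bounded by a multiple of \<open>w\<close>.
\<close>

locale contracting_kernel = sigma_finite_measure M for M :: "'a measure" +
  fixes k :: "'a \<Rightarrow> 'a \<Rightarrow> real" and w :: "'a \<Rightarrow> real" and q :: real
  assumes kernel_measurable [measurable]: "case_prod k \<in> borel_measurable (M \<Otimes>\<^sub>M M)"
    and kernel_nonneg: "\<And>x y. 0 \<le> k x y"
    and q_nonneg: "0 \<le> q" and q_less_1: "q < 1"
    and kernel_weight_integrable: "\<And>x. x \<in> space M \<Longrightarrow> integrable M (\<lambda>y. k x y * w y)"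
    and kernel_weight_bound: "\<And>x. x \<in> space M \<Longrightarrow> (LINT y|M. k x y * w y) \<le> q * w x"
begin

lemma kernel_section_measurable [measurable]: "x \<in> space M \<Longrightarrow> k x \<in> borel_measurable M"
  using measurable_compose[OF measurable_Pair1' kernel_measurable] by simp

lemma kernel_integrable:
  assumes [measurable]: "f \<in> borel_measurable M" and "AE y in M. \<bar>f y\<bar> \<le> C * w y" and x: "x \<in> space M"
  shows "integrable M (\<lambda>y. k x y * f y)"
proof (rule Bochner_Integration.integrable_bound)
  show "integrable M (\<lambda>y. C * (k x y * w y))"
    using kernel_weight_integrable[OF x] by simp
  show "AE y in M. norm (k x y * f y) \<le> norm (C * (k x y * w y))"
    using assms(2)
  proof eventually_elim
    case (elim y)
    have "\<bar>k x y * f y\<bar> \<le> k x y * (C * w y)"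
      using elim kernel_nonneg[of x y] by (simp add: abs_mult mult_left_mono)
    then show ?case by (simp add: mult.left_commute)
  qed
qed (use x in measurable)

lemma kernel_integral_le:
  assumes "f \<in> borel_measurable M" and bdd: "AE y in M. \<bar>f y\<bar> \<le> D * w y"
    and le: "AE y in M. f y \<le> C * w y" and "0 \<le> C" and x: "x \<in> space M"
  shows "(LINT y|M. k x y * f y) \<le> C * q * w x"
proof -
  have "(LINT y|M. k x y * f y) \<le> (LINT y|M. C * (k x y * w y))"
  proof (rule integral_mono_AE)
    show "integrable M (\<lambda>y. k x y * f y)"
      by (rule kernel_integrable) (use assms in auto)
    show "AE y in M. k x y * f y \<le> C * (k x y * w y)"
      using le
    proof eventually_elim
      case (elim y)
      show ?case using mult_left_mono[OF elim kernel_nonneg[of x y]] by (simp add: ac_simps)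
    qed
  qed (use kernel_weight_integrable[OF x] in simp)
  also have "\<dots> = C * (LINT y|M. k x y * w y)" by simp
  also have "\<dots> \<le> C * (q * w x)"
    using kernel_weight_bound[OF x] \<open>0 \<le> C\<close> by (rule mult_left_mono)
  finally show ?thesis by simp
qed

text \<open>
  Feeding the upper bound \<open>C * q ^ n * w\<close> for \<open>d\<close> back into \<open>d \<le> K d\<close> gains a factor \<open>q\<close>, because
  the kernel is nonnegative. The bounds tend to \<open>0\<close>, and only countably many exceptional null sets
  arise.
\<close>

lemma subsolution_nonpos:
  assumes d: "d \<in> borel_measurable M" and bdd: "AE x in M. \<bar>d x\<bar> \<le> C * w x" and "0 \<le> C"
    and sub: "AE x in M. d x \<le> (LINT y|M. k x y * d y)"
  shows "AE x in M. d x \<le> 0"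
proof -
  have bound: "AE x in M. d x \<le> C * q ^ n * w x" for n
  proof (induction n)
    case 0
    show ?case using bdd by eventually_elim auto
  next
    case (Suc n)
    have "0 \<le> C * q ^ n" using \<open>0 \<le> C\<close> q_nonneg by simp
    then have *: "(LINT y|M. k x y * d y) \<le> C * q ^ n * q * w x" if "x \<in> space M" for x
      using kernel_integral_le[OF d bdd Suc _ that] by simp
    show ?case using sub AE_space
    proof eventually_elim
      case (elim x)
      then show ?case using *[of x] by (simp add: ac_simps)
    qed
  qed
  then have "AE x in M. \<forall>n. d x \<le> C * q ^ n * w x"
    by (simp add: AE_all_countable)
  then show ?thesis
  proof eventually_elim
    case (elim x)
    have "(\<lambda>n. C * q ^ n * w x) \<longlonglongrightarrow> C * 0 * w x"
      using q_nonneg q_less_1 by (intro tendsto_intros LIMSEQ_realpow_zero)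
    then show ?case using elim by (intro LIMSEQ_le_const[of _ "C * 0 * w x", simplified]) auto
  qed
qed

primrec neumann_term :: "('a \<Rightarrow> real) \<Rightarrow> nat \<Rightarrow> 'a \<Rightarrow> real" where
  "neumann_term g 0 = g"
| "neumann_term g (Suc n) = (\<lambda>x. LINT y|M. k x y * neumann_term g n y)"

lemma neumann_term_measurable [measurable]:
  assumes [measurable]: "g \<in> borel_measurable M"
  shows "neumann_term g n \<in> borel_measurable M"
proof (induction n)
  case (Suc n)
  note [measurable] = Suc
  show ?case by (simp only: neumann_term.simps) measurable
qed (simp add: assms)

text \<open>
  The one-sided estimate of \<open>kernel_integral_le\<close>, applied to the \<open>n\<close>-th term and to its negative,
  gives the geometric decay that makes the Neumann series converge.
\<close>

lemma neumann_term_bound: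
  assumes g: "g \<in> borel_measurable M" and bdd: "\<And>x. x \<in> space M \<Longrightarrow> \<bar>g x\<bar> \<le> C * w x" and "0 \<le> C"
    and "x \<in> space M"
  shows "\<bar>neumann_term g n x\<bar> \<le> C * q ^ n * w x"
  using \<open>x \<in> space M\<close>
proof (induction n arbitrary: x)
  case (Suc n)
  let ?u = "neumann_term g n"
  have u: "?u \<in> borel_measurable M" using g by (rule neumann_term_measurable)
  have C: "0 \<le> C * q ^ n" using \<open>0 \<le> C\<close> q_nonneg by simp
  have "(LINT y|M. k x y * ?u y) \<le> C * q ^ n * q * w x"
  proof (rule kernel_integral_le[OF u _ _ C Suc.prems])
    show "AE y in M. \<bar>?u y\<bar> \<le> C * q ^ n * w y" using Suc.IH by (intro AE_I2)
    show "AE y in M. ?u y \<le> C * q ^ n * w y" using Suc.IH by (intro AE_I2) (simp add: abs_le_iff)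
  qed
  moreover have "(LINT y|M. k x y * - ?u y) \<le> C * q ^ n * q * w x"
  proof (rule kernel_integral_le[OF _ _ _ C Suc.prems])
    show "(\<lambda>y. - ?u y) \<in> borel_measurable M" using u by simp
    show "AE y in M. \<bar>- ?u y\<bar> \<le> C * q ^ n * w y" using Suc.IH by (intro AE_I2) simp
    show "AE y in M. - ?u y \<le> C * q ^ n * w y" using Suc.IH by (intro AE_I2) (simp add: abs_le_iff)
  qed
  ultimately show ?case by (simp add: abs_le_iff ac_simps)
qed (use bdd in simp)

text \<open>
  The Neumann series is dominated by a geometric series times \<open>w\<close>, which permits integrating it
  against the kernel term by term; this shifts the series by one index.
\<close>

lemma solution_exists:
  assumes g [measurable]: "g \<in> borel_measurable M"
    and bdd: "\<And>x. x \<in> space M \<Longrightarrow> \<bar>g x\<bar> \<le> C * w x" and "0 \<le> C"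
  shows "\<exists>u \<in> borel_measurable M. \<forall>x \<in> space M.
    \<bar>u x\<bar> \<le> C / (1 - q) * w x \<and> u x = g x + (LINT y|M. k x y * u y)"
proof -
  let ?v = "neumann_term g"
  define u where "u x = (\<Sum>n. ?v n x)" for x
  note bound = neumann_term_bound[OF g bdd \<open>0 \<le> C\<close>]
  have geo: "(\<lambda>n. C * q ^ n * c) sums (C / (1 - q) * c)" for c
    using sums_mult2[OF sums_mult[OF geometric_sums[of q], of C], of c] q_nonneg q_less_1 by simp
  have summable_abs: "summable (\<lambda>n. \<bar>?v n x\<bar>)" if "x \<in> space M" for x
    by (rule summable_comparison_test[OF _ sums_summable[OF geo[of "w x"]]]) (use bound that in auto)
  have "u \<in> borel_measurable M" unfolding u_def by measurable
  moreover have "\<bar>u x\<bar> \<le> C / (1 - q) * w x" if x: "x \<in> space M" for x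
  proof -
    have "\<bar>u x\<bar> \<le> (\<Sum>n. \<bar>?v n x\<bar>)"
      unfolding u_def by (rule summable_rabs[OF summable_abs[OF x]])
    also have "\<dots> \<le> (\<Sum>n. C * q ^ n * w x)"
      by (rule suminf_le[OF bound[OF _ x] summable_abs[OF x] sums_summable[OF geo]]) auto
    finally show ?thesis using sums_unique[OF geo[of "w x"]] by simp
  qed
  moreover have "u x = g x + (LINT y|M. k x y * u y)" if x: "x \<in> space M" for x
  proof -
    have int: "integrable M (\<lambda>y. k x y * ?v n y)" for n
      by (rule kernel_integrable[where C = "C * q ^ n"]) (use bound x in \<open>auto intro!: AE_I2\<close>)
    have norm_le: "(LINT y|M. norm (k x y * ?v n y)) \<le> C * q ^ n * (q * w x)" for n
    proof -
      have "(LINT y|M. k x y * \<bar>?v n y\<bar>) \<le> C * q ^ n * q * w x"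
        by (rule kernel_integral_le[where D = "C * q ^ n"])
          (use bound x \<open>0 \<le> C\<close> q_nonneg in \<open>auto intro!: AE_I2\<close>)
      then show ?thesis by (simp add: abs_mult kernel_nonneg ac_simps)
    qed
    have "(LINT y|M. k x y * u y) = (LINT y|M. (\<Sum>n. k x y * ?v n y))"
      unfolding u_def
      by (intro Bochner_Integration.integral_cong refl suminf_mult[symmetric]
          summable_rabs_cancel[OF summable_abs])
    also have "\<dots> = (\<Sum>n. LINT y|M. k x y * ?v n y)"
    proof (rule integral_suminf[OF int])
      show "AE y in M. summable (\<lambda>n. norm (k x y * ?v n y))"
        using summable_abs by (auto intro!: AE_I2 summable_mult simp: abs_mult)
      show "summable (\<lambda>n. LINT y|M. norm (k x y * ?v n y))"
        by (rule summable_comparison_test[OF _ sums_summable[OF geo[of "q * w x"]]])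
          (use norm_le in auto)
    qed
    also have "\<dots> = (\<Sum>n. ?v (Suc n) x)" by simp
    also have "\<dots> = u x - g x"
      using suminf_split_head[OF summable_rabs_cancel[OF summable_abs[OF x]]] by (simp add: u_def)
    finally show ?thesis by simp
  qed
  ultimately show ?thesis by blast
qed

end

section \<open>The Volterra kernel and its exponential weight\<close>

lemma integral_excess_tendsto_0:
  fixes h :: "real \<Rightarrow> real"
  assumes "integrable lborel h"
  shows "(\<lambda>n. LINT s|lborel. max 0 (h s - real n)) \<longlonglongrightarrow> 0"
proof -
  have "(\<lambda>n. LINT s|lborel. max 0 (h s - real n)) \<longlonglongrightarrow> (LINT s|(lborel::real measure). 0)"
  proof (rule integral_dominated_convergence)
    show "integrable lborel (\<lambda>s. \<bar>h s\<bar>)" using assms by simp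
    show "AE s in lborel. (\<lambda>n. max 0 (h s - real n)) \<longlonglongrightarrow> 0"
    proof (rule AE_I2)
      fix s
      have "\<forall>\<^sub>F n in sequentially. max 0 (h s - real n) = 0"
        using eventually_ge_at_top[of "nat \<lceil>h s\<rceil>"] by eventually_elim linarith
      then show "(\<lambda>n. max 0 (h s - real n)) \<longlonglongrightarrow> 0" by (rule tendsto_eventually)
    qed
  qed (use assms in auto)
  then show ?thesis by simp
qed

lemma exp_window_integral:
  fixes t l :: real
  assumes "0 < l"
  shows "integrable lborel (\<lambda>s. indicator {0..t} s * exp (l * (s - t)))"
    and "(LINT s|lborel. indicator {0..t} s * exp (l * (s - t))) \<le> 1 / l"
proof -
  have "integrable lborel (\<lambda>s. indicator {0..t} s * exp (l * (s - t))) \<and>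
    (LINT s|lborel. indicator {0..t} s * exp (l * (s - t))) \<le> 1 / l"
  proof (cases "0 \<le> t")
    case True
    have "has_bochner_integral lborel (\<lambda>s. exp (l * (s - t)) * indicator {0..t} s)
      (exp (l * (t - t)) / l - exp (l * (0 - t)) / l)"
      using True assms
      by (intro has_bochner_integral_FTC_Icc_real) (auto intro!: derivative_eq_intros continuous_intros)
    moreover have "exp (l * (t - t)) / l - exp (l * (0 - t)) / l \<le> 1 / l"
      using assms by simp
    ultimately show ?thesis
      by (simp only: has_bochner_integral_iff mult.commute[of "indicator _ _"] simp_thms)
  qed (use assms in simp)
  then show "integrable lborel (\<lambda>s. indicator {0..t} s * exp (l * (s - t)))"
    and "(LINT s|lborel. indicator {0..t} s * exp (l * (s - t))) \<le> 1 / l" by auto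
qed

text \<open>
  On the window the exponential is at most \<open>1\<close>, so the excess of \<open>h\<close> over \<open>N\<close> contributes at most
  its own integral, while the part below \<open>N\<close> is controlled by the decay of the exponential. The
  bound depends on \<open>h\<close> only through the excess integral, which is what makes it uniform over the
  reflections \<open>s \<mapsto> h (t - s)\<close>.
\<close>

lemma exp_weighted_window_integral:
  fixes h :: "real \<Rightarrow> real"
  assumes h: "integrable lborel h" and nonneg: "\<And>s. 0 \<le> h s" and "0 < l" and "0 \<le> N"
  shows "integrable lborel (\<lambda>s. indicator {0<..<t} s * h s * exp (l * (s - t)))" (is ?I)
    and "(LINT s|lborel. indicator {0<..<t} s * h s * exp (l * (s - t)))
      \<le> N / l + (LINT s|lborel. max 0 (h s - N))" (is ?B)
proof -
  have [measurable]: "h \<in> borel_measurable lborel" using h by auto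
  note window = exp_window_integral[OF \<open>0 < l\<close>, of t]
  show I: ?I
    by (rule Bochner_Integration.integrable_bound[OF h])
      (use nonneg \<open>0 < l\<close> in \<open>auto intro!: AE_I2 mult_left_le simp: indicator_def abs_mult mult_nonneg_nonpos\<close>)
  have ex: "integrable lborel (\<lambda>s. max 0 (h s - N))"
    by (rule Bochner_Integration.integrable_bound[OF h]) (use nonneg \<open>0 \<le> N\<close> in \<open>auto intro!: AE_I2\<close>)
  have "(LINT s|lborel. indicator {0<..<t} s * h s * exp (l * (s - t)))
    \<le> (LINT s|lborel. N * (indicator {0..t} s * exp (l * (s - t))) + max 0 (h s - N))"
  proof (rule integral_mono[OF I])
    show "integrable lborel (\<lambda>s. N * (indicator {0..t} s * exp (l * (s - t))) + max 0 (h s - N))"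
      using window ex by simp
    fix s
    show "indicator {0<..<t} s * h s * exp (l * (s - t))
      \<le> N * (indicator {0..t} s * exp (l * (s - t))) + max 0 (h s - N)"
    proof (cases "0 < s \<and> s < t")
      case True
      then have "exp (l * (s - t)) \<le> 1" using \<open>0 < l\<close> by (simp add: mult_nonneg_nonpos)
      then have "max 0 (h s - N) * exp (l * (s - t)) \<le> max 0 (h s - N)"
        by (intro mult_left_le) auto
      moreover have "h s * exp (l * (s - t)) \<le> (N + max 0 (h s - N)) * exp (l * (s - t))"
        by (intro mult_right_mono) auto
      ultimately show ?thesis using True by (simp add: distrib_right)
    qed (use \<open>0 \<le> N\<close> in \<open>auto simp: indicator_def\<close>)
  qed
  also have "\<dots> = N * (LINT s|lborel. indicator {0..t} s * exp (l * (s - t)))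
      + (LINT s|lborel. max 0 (h s - N))"
    using window(1) ex by simp
  also have "\<dots> \<le> N / l + (LINT s|lborel. max 0 (h s - N))"
    using mult_left_mono[OF window(2) \<open>0 \<le> N\<close>] by simp
  finally show ?B .
qed

lemma reflect_lborel_integral:
  fixes h :: "real \<Rightarrow> real"
  shows "(LINT s|lborel. h (t - s)) = (LINT s|lborel. h s)"
  using lborel_integral_real_affine[of "-1" h t] by simp

text \<open>
  The cut-off at \<open>t < T\<close> confines the integral operator to \<open>(0,T)\<close>: data vanishing outside this
  interval lead to solutions vanishing there, and inequalities assumed on the interval extend
  trivially to the whole line.
\<close>

definition volterra_kernel :: "real \<Rightarrow> (real \<Rightarrow> real) \<Rightarrow> (real \<Rightarrow> real) \<Rightarrow> real \<Rightarrow> real \<Rightarrow> real" where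
  "volterra_kernel T a b t s = (if 0 < s \<and> s < t \<and> t < T then a s + b (t - s) else 0)"

lemma volterra_kernel_contracting:
  assumes a: "integrable lborel a" "\<And>s. 0 \<le> a s" and b: "integrable lborel b" "\<And>s. 0 \<le> b s"
  obtains l where "0 < l"
    and "contracting_kernel lborel (volterra_kernel T a b) (\<lambda>t. exp (l * t)) (1 / 2)"
proof -
  have "\<forall>\<^sub>F n in sequentially. (LINT s|lborel. max 0 (a s - real n)) < 1 / 8"
    using integral_excess_tendsto_0[OF a(1)] by (rule order_tendstoD) simp
  moreover have "\<forall>\<^sub>F n in sequentially. (LINT s|lborel. max 0 (b s - real n)) < 1 / 8"
    using integral_excess_tendsto_0[OF b(1)] by (rule order_tendstoD) simp
  ultimately have "\<forall>\<^sub>F n in sequentially. (LINT s|lborel. max 0 (a s - real n)) < 1 / 8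
      \<and> (LINT s|lborel. max 0 (b s - real n)) < 1 / 8"
    by eventually_elim simp
  then obtain n where n: "(LINT s|lborel. max 0 (a s - real n)) < 1 / 8"
      "(LINT s|lborel. max 0 (b s - real n)) < 1 / 8"
    by (auto simp: eventually_sequentially)
  \<comment> \<open>Each coefficient gets a quarter: an eighth from its excess over \<open>n\<close>, an eighth from \<open>n / l\<close>.\<close>
  define l where "l = 8 * (real n + 1)"
  have "0 < l" by (simp add: l_def)
  have ratio: "real n / l \<le> 1 / 8" by (simp add: l_def field_simps)
  have [measurable]: "a \<in> borel_measurable borel" "b \<in> borel_measurable borel"
    using a b by auto
  define b' where "b' t s = b (t - s)" for t s
  have b': "integrable lborel (b' t)" "\<And>s. 0 \<le> b' t s" for t
    using lborel_integrable_real_affine[OF b(1), of "-1" t] b(2) by (simp_all add: b'_def[abs_def])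
  note A = exp_weighted_window_integral[OF a \<open>0 < l\<close>, of "real n"]
    and B = exp_weighted_window_integral[OF b' \<open>0 < l\<close>, of "real n"]
  have kernel_eq: "volterra_kernel T a b t s * exp (l * s) =
      exp (l * t) * (indicator {0<..<t} s * a s * exp (l * (s - t))
        + indicator {0<..<t} s * b' t s * exp (l * (s - t)))" if "t < T" for t s
    using that by (auto simp: volterra_kernel_def b'_def indicator_def algebra_simps exp_add[symmetric])
  have int_bound: "integrable lborel (\<lambda>s. volterra_kernel T a b t s * exp (l * s)) \<and>
      (LINT s|lborel. volterra_kernel T a b t s * exp (l * s)) \<le> 1 / 2 * exp (l * t)" for t
  proof (cases "t < T")
    case True
    have "(LINT s|lborel. indicator {0<..<t} s * a s * exp (l * (s - t)))
        + (LINT s|lborel. indicator {0<..<t} s * b' t s * exp (l * (s - t))) \<le> 1 / 2"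
      using A(2)[of t] B(2)[of t t] n ratio
        reflect_lborel_integral[of "\<lambda>s. max 0 (b s - real n)" t]
      by (simp add: b'_def)
    from mult_left_mono[OF this, of "exp (l * t)"] show ?thesis
      unfolding kernel_eq[OF True] using A(1)[of t] B(1)[of t t] by simp
  qed (simp add: volterra_kernel_def)
  have "contracting_kernel lborel (volterra_kernel T a b) (\<lambda>t. exp (l * t)) (1 / 2)"
  proof
    show "case_prod (volterra_kernel T a b) \<in> borel_measurable (lborel \<Otimes>\<^sub>M lborel)"
      unfolding volterra_kernel_def[abs_def] by measurable
  qed (use int_bound a b in \<open>auto simp: volterra_kernel_def\<close>)
  with \<open>0 < l\<close> show ?thesis by (rule that)
qed

lemma bounded_le_exp_weight:
  fixes z :: "real \<Rightarrow> real"
  assumes "\<And>t. \<bar>z t\<bar> \<le> C" and "\<And>t. t \<notin> {0<..<T} \<Longrightarrow> z t = 0" and "0 \<le> C" and "0 < l"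
  shows "\<bar>z t\<bar> \<le> C * exp (l * t)"
proof (cases "t \<in> {0<..<T}")
  case True
  then have "C * 1 \<le> C * exp (l * t)"
    using \<open>0 \<le> C\<close> \<open>0 < l\<close> by (intro mult_left_mono) auto
  then show ?thesis using assms(1)[of t] by linarith
qed (use assms in simp)

section \<open>Borel representatives\<close>

lemma AE_lebesgue_on_interval_iff:
  "(AE t in lebesgue_on {a<..<b::real}. P t) \<longleftrightarrow> (AE t in lborel. t \<in> {a<..<b} \<longrightarrow> P t)"
  by (subst AE_restrict_space_iff) (auto simp: AE_completion_iff)

lemma AE_lborel_reflect:
  fixes P :: "real \<Rightarrow> bool"
  assumes "AE s in lborel. P s"
  shows "AE s in lborel. P (t - s)"
proof -
  obtain N where N: "N \<in> null_sets lborel" "{s \<in> space lborel. \<not> P s} \<subseteq> N"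
    using assms by (auto simp: eventually_ae_filter)
  have [measurable]: "N \<in> sets borel" using N by auto
  have "AE s in lborel. t + -1 * s \<notin> N"
    by (rule AE_borel_affine) (use AE_not_in[OF N(1)] in auto)
  then show ?thesis by eventually_elim (use N(2) in auto)
qed

text \<open>
  A representative that is Borel on the whole line and vanishes off the interval, so that it can be
  used with a kernel and a weight defined on all of \<open>\<real>\<close>.
\<close>

lemma Borel_representative:
  fixes f :: "real \<Rightarrow> real"
  assumes "f \<in> borel_measurable (lebesgue_on {0<..<T})"
  obtains f' where "f' \<in> borel_measurable borel" "AE t in lborel. t \<in> {0<..<T} \<longrightarrow> f t = f' t"
    "\<And>t. t \<notin> {0<..<T} \<Longrightarrow> f' t = 0"
proof -
  have "(\<lambda>t. indicator {0<..<T} t *\<^sub>R f t) \<in> borel_measurable lebesgue"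
    using assms by (subst (asm) borel_measurable_restrict_space_iff) auto
  then obtain f0 where f0 [measurable]: "f0 \<in> borel_measurable borel"
      and eq: "AE t in lborel. indicator {0<..<T} t *\<^sub>R f t = f0 t"
    by (auto dest!: completion_ex_borel_measurable_real)
  show ?thesis
  proof (rule that[of "\<lambda>t. indicator {0<..<T} t * f0 t"])
    show "AE t in lborel. t \<in> {0<..<T} \<longrightarrow> f t = indicator {0<..<T} t * f0 t"
      using eq by eventually_elim (auto simp: indicator_def)
  qed auto
qed

lemma Linf_Borel_representative:
  assumes "f \<in> Linf T"
  obtains f' C where "f' \<in> borel_measurable borel" "AE t in lborel. t \<in> {0<..<T} \<longrightarrow> f t = f' t"
    "\<And>t. t \<notin> {0<..<T} \<Longrightarrow> f' t = 0" "0 \<le> C" "\<And>t. \<bar>f' t\<bar> \<le> C"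
proof -
  obtain C where C: "AE t in lborel. t \<in> {0<..<T} \<longrightarrow> \<bar>f t\<bar> \<le> C"
    using assms by (auto simp: Linf_def AE_lebesgue_on_interval_iff)
  have meas: "f \<in> borel_measurable (lebesgue_on {0<..<T})"
    using assms by (simp add: Linf_def)
  obtain f0 where f0 [measurable]: "f0 \<in> borel_measurable borel"
    and eq: "AE t in lborel. t \<in> {0<..<T} \<longrightarrow> f t = f0 t"
    and zero: "\<And>t. t \<notin> {0<..<T} \<Longrightarrow> f0 t = 0"
    using Borel_representative[OF meas] by blast
  show ?thesis
  proof (rule that[of "\<lambda>t. if \<bar>f0 t\<bar> \<le> C then f0 t else 0" "max 0 C"])
    show "AE t in lborel. t \<in> {0<..<T} \<longrightarrow> f t = (if \<bar>f0 t\<bar> \<le> C then f0 t else 0)"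
      using eq C by eventually_elim auto
  qed (use zero in auto)
qed

lemma L1_nonneg_Borel_representative:
  assumes "g \<in> L1 T" and "AE t in lebesgue_on {0<..<T}. 0 \<le> g t"
  obtains g' where "integrable lborel g'" "\<And>t. 0 \<le> g' t"
    "AE t in lborel. t \<in> {0<..<T} \<longrightarrow> g t = g' t"
proof -
  have int: "integrable lebesgue (\<lambda>t. indicator {0<..<T} t *\<^sub>R g t)"
    using assms(1) by (simp add: L1_def integrable_restrict_space)
  have nonneg: "AE t in lborel. t \<in> {0<..<T} \<longrightarrow> 0 \<le> g t"
    using assms(2) by (simp add: AE_lebesgue_on_interval_iff)
  have meas: "g \<in> borel_measurable (lebesgue_on {0<..<T})"
    using assms(1) by (auto simp: L1_def)
  obtain g0 where g0 [measurable]: "g0 \<in> borel_measurable borel"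
    and eq: "AE t in lborel. t \<in> {0<..<T} \<longrightarrow> g t = g0 t"
    and zero: "\<And>t. t \<notin> {0<..<T} \<Longrightarrow> g0 t = 0"
    using Borel_representative[OF meas] by blast
  let ?g = "\<lambda>t. max 0 (g0 t)"
  have ae: "AE t in lborel. indicator {0<..<T} t *\<^sub>R g t = ?g t"
    using eq nonneg by eventually_elim (use zero in \<open>auto simp: indicator_def\<close>)
  have "integrable lebesgue ?g"
  proof (rule integrable_cong_AE_imp[OF int])
    show "?g \<in> borel_measurable lebesgue" by (rule measurable_completion) simp
    show "AE t in lebesgue. indicator {0<..<T} t *\<^sub>R g t = ?g t"
      using ae by (rule AE_completion)
  qed
  then have "integrable lborel ?g" by (simp add: integrable_completion)
  moreover have "AE t in lborel. t \<in> {0<..<T} \<longrightarrow> g t = ?g t"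
    using eq nonneg by eventually_elim auto
  ultimately show ?thesis by (intro that) auto
qed

lemma lebesgue_on_integral_eq_lborel:
  fixes h h' :: "real \<Rightarrow> real"
  assumes "h' \<in> borel_measurable borel" and "AE s in lborel. s \<in> {a<..<b} \<longrightarrow> h s = h' s"
  shows "(LINT s|lebesgue_on {a<..<b}. h s) = (LINT s|lborel. indicator {a<..<b} s * h' s)"
proof -
  have ae: "AE s in lebesgue. indicator {a<..<b} s * h' s = indicator {a<..<b} s * h s"
    by (rule AE_completion) (use assms(2) in eventually_elim, simp add: indicator_def)
  have m: "(\<lambda>s. indicator {a<..<b} s * h' s) \<in> borel_measurable lborel" using assms(1) by measurable
  have "(LINT s|lebesgue_on {a<..<b}. h s) = (LINT s|lebesgue. indicator {a<..<b} s * h s)"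
    by (subst integral_restrict_space) auto
  also have "\<dots> = (LINT s|lebesgue. indicator {a<..<b} s * h' s)"
  proof (rule integral_cong_AE)
    show "(\<lambda>s. indicator {a<..<b} s * h s) \<in> borel_measurable lebesgue"
      by (rule borel_measurable_AE[OF measurable_completion[OF m] ae])
    show "AE s in lebesgue. indicator {a<..<b} s * h s = indicator {a<..<b} s * h' s"
      using ae by eventually_elim (rule sym)
  qed (rule measurable_completion[OF m])
  finally show ?thesis by (simp add: integral_completion[OF m])
qed

text \<open>
  The right-hand side is insensitive to null sets at every single \<open>t\<close>: the points \<open>s\<close> where \<open>g3\<close> and
  its representative differ at \<open>t - s\<close> form the reflection of a null set.
\<close>

lemma volterra_rhs_eq_kernel_integral:
  assumes t: "t \<in> {0<..<T}"
    and g2: "integrable lborel a" "AE s in lborel. s \<in> {0<..<T} \<longrightarrow> g2 s = a s"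
    and g3: "integrable lborel b" "AE s in lborel. s \<in> {0<..<T} \<longrightarrow> g3 s = b s"
    and f: "u \<in> borel_measurable borel" "AE s in lborel. s \<in> {0<..<T} \<longrightarrow> f s = u s"
    and bdd: "\<And>s. \<bar>u s\<bar> \<le> C"
  shows "volterra_rhs g1 g2 g3 f t = g1 t + (LINT s|lborel. volterra_kernel T a b t s * u s)"
proof -
  have [measurable]: "a \<in> borel_measurable borel" "b \<in> borel_measurable borel" "u \<in> borel_measurable borel"
    using g2 g3 f by auto
  have b': "integrable lborel (\<lambda>s. b (t - s))"
    using lborel_integrable_real_affine[OF g3(1), of "-1" t] by simp
  have bounded_mult: "integrable lborel (\<lambda>s. indicator {0<..<t} s * (h s * u s))"
    if h: "integrable lborel h" for h
  proof (rule Bochner_Integration.integrable_bound)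
    show "integrable lborel (\<lambda>s. C * h s)" using h by simp
    have [measurable]: "h \<in> borel_measurable borel" using h by auto
    show "(\<lambda>s. indicator {0<..<t} s * (h s * u s)) \<in> borel_measurable lborel" by measurable
    have "0 \<le> C" using bdd[of 0] by linarith
    have "\<bar>h s\<bar> * \<bar>u s\<bar> \<le> C * \<bar>h s\<bar>" for s
      using mult_right_mono[OF bdd[of s], of "\<bar>h s\<bar>"] by (simp add: mult.commute)
    then show "AE s in lborel. norm (indicator {0<..<t} s * (h s * u s)) \<le> norm (C * h s)"
      using \<open>0 \<le> C\<close> by (intro AE_I2) (auto simp: indicator_def abs_mult)
  qed
  have "(LINT s|lebesgue_on {0<..<t}. g2 s * f s) = (LINT s|lborel. indicator {0<..<t} s * (a s * u s))"
  proof (rule lebesgue_on_integral_eq_lborel)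
    show "AE s in lborel. s \<in> {0<..<t} \<longrightarrow> g2 s * f s = a s * u s"
      using g2(2) f(2) by eventually_elim (use t in auto)
  qed measurable
  moreover have "conv g3 f t = (LINT s|lborel. indicator {0<..<t} s * (b (t - s) * u s))"
    unfolding conv_def
  proof (rule lebesgue_on_integral_eq_lborel)
    show "AE s in lborel. s \<in> {0<..<t} \<longrightarrow> g3 (t - s) * f s = b (t - s) * u s"
      using AE_lborel_reflect[OF g3(2), of t] f(2) by eventually_elim (use t in auto)
  qed measurable
  moreover have "volterra_kernel T a b t s * u s
      = indicator {0<..<t} s * (a s * u s) + indicator {0<..<t} s * (b (t - s) * u s)" for s
    using t by (auto simp: volterra_kernel_def indicator_def algebra_simps)
  ultimately show ?thesis
    using bounded_mult[OF g2(1)] bounded_mult[OF b'] by (simp add: volterra_rhs_def)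
qed

section \<open>Comparison and existence\<close>

text \<open>
  A bounded subsolution lies below a bounded supersolution: in the difference of the two
  inequalities \<open>g1\<close> cancels, and what remains is \<open>d \<le> K d\<close> for representatives vanishing off
  \<open>(0,T)\<close>.
\<close>

lemma volterra_comparison:
  assumes g2: "g2 \<in> L1 T" "AE t in lebesgue_on {0<..<T}. 0 \<le> g2 t"
    and g3: "g3 \<in> L1 T" "AE t in lebesgue_on {0<..<T}. 0 \<le> g3 t"
    and f: "f \<in> Linf T" "AE t in lebesgue_on {0<..<T}. f t \<le> volterra_rhs g1 g2 g3 f t"
    and h: "h \<in> Linf T" "AE t in lebesgue_on {0<..<T}. volterra_rhs g1 g2 g3 h t \<le> h t"
  shows "AE t in lebesgue_on {0<..<T}. f t \<le> h t"
proof -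
  obtain a where a: "integrable lborel a" "\<And>t. 0 \<le> a t" "AE t in lborel. t \<in> {0<..<T} \<longrightarrow> g2 t = a t"
    using L1_nonneg_Borel_representative[OF g2] by blast
  obtain b where b: "integrable lborel b" "\<And>t. 0 \<le> b t" "AE t in lborel. t \<in> {0<..<T} \<longrightarrow> g3 t = b t"
    using L1_nonneg_Borel_representative[OF g3] by blast
  obtain l where "0 < l"
    and contr: "contracting_kernel lborel (volterra_kernel T a b) (\<lambda>t. exp (l * t)) (1 / 2)"
    using volterra_kernel_contracting[OF a(1,2) b(1,2)] by blast
  interpret contracting_kernel lborel "volterra_kernel T a b" "\<lambda>t. exp (l * t)" "1 / 2"
    by (rule contr)
  obtain u C where u: "u \<in> borel_measurable borel" "AE t in lborel. t \<in> {0<..<T} \<longrightarrow> f t = u t"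
    "\<And>t. t \<notin> {0<..<T} \<Longrightarrow> u t = 0" "0 \<le> C" "\<And>t. \<bar>u t\<bar> \<le> C"
    using Linf_Borel_representative[OF f(1)] by blast
  obtain v D where v: "v \<in> borel_measurable borel" "AE t in lborel. t \<in> {0<..<T} \<longrightarrow> h t = v t"
    "\<And>t. t \<notin> {0<..<T} \<Longrightarrow> v t = 0" "0 \<le> D" "\<And>t. \<bar>v t\<bar> \<le> D"
    using Linf_Borel_representative[OF h(1)] by blast
  have u_le: "\<bar>u t\<bar> \<le> C * exp (l * t)" for t
    by (rule bounded_le_exp_weight[of u]) (use u \<open>0 < l\<close> in auto)
  have v_le: "\<bar>v t\<bar> \<le> D * exp (l * t)" for t
    by (rule bounded_le_exp_weight[of v]) (use v \<open>0 < l\<close> in auto)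
  have int_u: "integrable lborel (\<lambda>s. volterra_kernel T a b t s * u s)" for t
    by (rule kernel_integrable[where C = C]) (use u(1) u_le in auto)
  have int_v: "integrable lborel (\<lambda>s. volterra_kernel T a b t s * v s)" for t
    by (rule kernel_integrable[where C = D]) (use v(1) v_le in auto)
  have "AE t in lborel. u t - v t \<le> 0"
  proof (rule subsolution_nonpos[where C = "C + D"])
    show "AE t in lborel. \<bar>u t - v t\<bar> \<le> (C + D) * exp (l * t)"
    proof (rule AE_I2)
      fix t
      show "\<bar>u t - v t\<bar> \<le> (C + D) * exp (l * t)"
        using u_le[of t] v_le[of t] unfolding distrib_right by linarith
    qed
    have "AE t in lborel. t \<in> {0<..<T} \<longrightarrow> f t \<le> volterra_rhs g1 g2 g3 f t"
        "AE t in lborel. t \<in> {0<..<T} \<longrightarrow> volterra_rhs g1 g2 g3 h t \<le> h t"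
      using f h by (simp_all add: AE_lebesgue_on_interval_iff)
    then show "AE t in lborel. u t - v t \<le> (LINT s|lborel. volterra_kernel T a b t s * (u s - v s))"
      using u(2) v(2)
    proof eventually_elim
      case (elim t)
      show ?case
      proof (cases "t \<in> {0<..<T}")
        case True
        have "u t - v t \<le> (LINT s|lborel. volterra_kernel T a b t s * u s)
            - (LINT s|lborel. volterra_kernel T a b t s * v s)"
          using elim True
            volterra_rhs_eq_kernel_integral[OF True a(1,3) b(1,3) u(1,2,5), of g1]
            volterra_rhs_eq_kernel_integral[OF True a(1,3) b(1,3) v(1,2,5), of g1]
          by simp
        then show ?thesis using int_u int_v by (simp add: right_diff_distrib)
      next
        case False
        then have "volterra_kernel T a b t s = 0" for s by (auto simp: volterra_kernel_def)
        then show ?thesis using False u(3) v(3) by simp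
      qed
    qed
  qed (use u v in auto)
  then show ?thesis
    unfolding AE_lebesgue_on_interval_iff using u(2) v(2) by eventually_elim auto
qed

lemma volterra_solution_exists:
  assumes g1: "g1 \<in> Linf T"
    and g2: "g2 \<in> L1 T" "AE t in lebesgue_on {0<..<T}. 0 \<le> g2 t"
    and g3: "g3 \<in> L1 T" "AE t in lebesgue_on {0<..<T}. 0 \<le> g3 t"
  obtains G where "volterra_solution T g1 g2 g3 G"
proof -
  obtain a where a: "integrable lborel a" "\<And>t. 0 \<le> a t" "AE t in lborel. t \<in> {0<..<T} \<longrightarrow> g2 t = a t"
    using L1_nonneg_Borel_representative[OF g2] by blast
  obtain b where b: "integrable lborel b" "\<And>t. 0 \<le> b t" "AE t in lborel. t \<in> {0<..<T} \<longrightarrow> g3 t = b t"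
    using L1_nonneg_Borel_representative[OF g3] by blast
  obtain l where "0 < l"
    and contr: "contracting_kernel lborel (volterra_kernel T a b) (\<lambda>t. exp (l * t)) (1 / 2)"
    using volterra_kernel_contracting[OF a(1,2) b(1,2)] by blast
  interpret contracting_kernel lborel "volterra_kernel T a b" "\<lambda>t. exp (l * t)" "1 / 2"
    by (rule contr)
  obtain g C where g: "g \<in> borel_measurable borel" "AE t in lborel. t \<in> {0<..<T} \<longrightarrow> g1 t = g t"
    "\<And>t. t \<notin> {0<..<T} \<Longrightarrow> g t = 0" "0 \<le> C" "\<And>t. \<bar>g t\<bar> \<le> C"
    using Linf_Borel_representative[OF g1] by blast
  have g_le: "\<bar>g t\<bar> \<le> C * exp (l * t)" for t
    by (rule bounded_le_exp_weight[of g]) (use g \<open>0 < l\<close> in auto)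
  have g_lborel: "g \<in> borel_measurable lborel" using g(1) by simp
  obtain u where u_lborel: "u \<in> borel_measurable lborel"
    and sol: "\<forall>t \<in> space lborel. \<bar>u t\<bar> \<le> C / (1 - 1 / 2) * exp (l * t)
      \<and> u t = g t + (LINT s|lborel. volterra_kernel T a b t s * u s)"
    using solution_exists[OF g_lborel g_le \<open>0 \<le> C\<close>] by (rule bexE)
  have u: "u \<in> borel_measurable borel" using u_lborel by simp
  have "t \<in> space lborel" for t :: real by simp
  with sol have u_bound: "\<bar>u t\<bar> \<le> C / (1 - 1 / 2) * exp (l * t)"
    and u_eq: "u t = g t + (LINT s|lborel. volterra_kernel T a b t s * u s)" for t
    by blast+
  define D where "D = 2 * C * exp (l * T)"
  have u_le: "\<bar>u t\<bar> \<le> D" for t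
  proof (cases "t \<in> {0<..<T}")
    case True
    then have "2 * C * exp (l * t) \<le> D"
      unfolding D_def using \<open>0 \<le> C\<close> \<open>0 < l\<close> by (intro mult_left_mono) auto
    then show ?thesis using u_bound[of t] by (simp add: mult.commute)
  next
    case False
    then have "volterra_kernel T a b t s = 0" for s by (auto simp: volterra_kernel_def)
    then show ?thesis using u_eq[of t] g(3)[OF False] \<open>0 \<le> C\<close> by (simp add: D_def)
  qed
  have "u \<in> Linf T"
    using u u_le by (auto simp: Linf_def intro!: measurable_restrict_space1 measurable_completion)
  moreover have "AE t in lborel. t \<in> {0<..<T} \<longrightarrow> u t = volterra_rhs g1 g2 g3 u t"
    using g(2)
  proof eventually_elim
    case (elim t)
    show ?case
    proof
      assume t: "t \<in> {0<..<T}"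
      then show "u t = volterra_rhs g1 g2 g3 u t"
        using elim u_eq[of t] volterra_rhs_eq_kernel_integral[OF t a(1,3) b(1,3) u _ u_le, of u g1]
        by simp
    qed
  qed
  ultimately show ?thesis
    by (intro that) (simp add: volterra_solution_def AE_lebesgue_on_interval_iff)
qed

theorem proposition4p3:
  fixes T :: real and g1 g2 g3 :: "real \<Rightarrow> real"
  assumes "0 < T"
    and "g1 \<in> Linf T"
    and "g2 \<in> L1 T" and "AE t in lebesgue_on {0<..<T}. 0 \<le> g2 t"
    and "g3 \<in> L1 T" and "AE t in lebesgue_on {0<..<T}. 0 \<le> g3 t"
  shows "\<exists>G. volterra_solution T g1 g2 g3 G
    \<and> (\<forall>H. volterra_solution T g1 g2 g3 H \<longrightarrow> (AE t in lebesgue_on {0<..<T}. H t = G t))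
    \<and> (\<forall>f. f \<in> Linf T
          \<longrightarrow> (AE t in lebesgue_on {0<..<T}. f t \<le> volterra_rhs g1 g2 g3 f t)
          \<longrightarrow> (AE t in lebesgue_on {0<..<T}. f t \<le> G t))"
proof -
  note compare = volterra_comparison[OF assms(3-6)]
  obtain G where G: "volterra_solution T g1 g2 g3 G"
    using volterra_solution_exists[OF assms(2-6)] .
  have solD: "H \<in> Linf T" "AE t in lebesgue_on {0<..<T}. H t \<le> volterra_rhs g1 g2 g3 H t"
      "AE t in lebesgue_on {0<..<T}. volterra_rhs g1 g2 g3 H t \<le> H t"
    if "volterra_solution T g1 g2 g3 H" for H
  proof -
    from that have eq: "AE t in lebesgue_on {0<..<T}. H t = volterra_rhs g1 g2 g3 H t"
      and "H \<in> Linf T" by (auto simp: volterra_solution_def)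
    show "H \<in> Linf T" by fact
    show "AE t in lebesgue_on {0<..<T}. H t \<le> volterra_rhs g1 g2 g3 H t"
      "AE t in lebesgue_on {0<..<T}. volterra_rhs g1 g2 g3 H t \<le> H t"
      using eq by (eventually_elim, simp)+
  qed
  have "AE t in lebesgue_on {0<..<T}. H t = G t" if H: "volterra_solution T g1 g2 g3 H" for H
    using compare[OF solD(1,2)[OF H] solD(1,3)[OF G]] compare[OF solD(1,2)[OF G] solD(1,3)[OF H]]
    by eventually_elim auto
  then show ?thesis using G compare[OF _ _ solD(1,3)[OF G]] by blast
qed

end
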